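(* For all $k \in \mathbb{N}$, the smallest positive period $P_k$ of $g_k$ is a multiple of the positive integer $\frac{\mathrm{lcm}(1, 2, \dots, k, k+1)}{k+1}$. In addition, for all $k \in \mathbb{N}$ for which $k+1$ is prime, $P_k = \mathrm{lcm}(1, 2, \dots, k)$.
   Context: $\mathbb{N}$ denotes the nonnegative integers and $\mathbb{N}^* = \mathbb{N} \setminus \{0\}$. For $k \in \mathbb{N}$, the function $g_k : \mathbb{N}^* \to \mathbb{N}^*$ is defined by $g_k(n) = \frac{n(n+1)\cdots(n+k)}{\mathrm{lcm}(n, n+1, \dots, n+k)}$. It is known that $g_k$ is periodic. $P_k$ denotes the exact (i.e. smallest positive) period of $g_k$: the least positive integer $T$ such that $g_k(n+T) = g_k(n)$ for all $n \in \mathbb{N}^*$. *)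

theory Defs
  imports "HOL-Computational_Algebra.Primes"
begin

text \<open>
  Only the values at \<open>n > 0\<close> are meaningful; there \<open>div\<close> is exact
  by \<open>Lcm_dvd_prod\<close> below.
\<close>
definition g :: "nat \<Rightarrow> nat \<Rightarrow> nat" where
  "g k n = (\<Prod>i=n..n+k. i) div Lcm {n..n+k}"

text \<open>Periods are understood for \<open>g k\<close> restricted to the positive integers.\<close>
definition is_period :: "nat \<Rightarrow> nat \<Rightarrow> bool" where
  "is_period k T \<longleftrightarrow> T > 0 \<and> (\<forall>n>0. g k (n + T) = g k n)"

definition P :: "nat \<Rightarrow> nat" where
  "P k = (LEAST T. is_period k T)"

lemma Lcm_dvd_prod: "Lcm {n..n+k} dvd (\<Prod>i=n..n+k. i :: nat)"
  by (rule Lcm_least) (auto intro: dvd_prodI)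

lemma g_pos:
  assumes "n > 0"
  shows "g k n > 0"
proof -
  have "(\<Prod>i=n..n+k. i) > 0"
    using assms by (intro prod_pos) auto
  then show ?thesis
    using Lcm_dvd_prod[of n k] unfolding g_def
    by (metis dvd_div_eq_0_iff gr0I less_irrefl)
qed

lemma Suc_dvd_Lcm: "k + 1 dvd Lcm {1..k+1::nat}"
  by (rule dvd_Lcm) auto

lemma Lcm_div_pos: "Lcm {1..k+1::nat} div (k+1) > 0"
proof -
  have "Lcm {1..k+1::nat} \<noteq> 0"
    by (subst Lcm_0_iff) auto
  then show ?thesis
    using Suc_dvd_Lcm[of k] by (metis dvd_div_eq_0_iff gr0I)
qed

lemma gcd_Lcm_distrib:
  fixes m :: nat
  assumes "finite A"
  shows "gcd m (Lcm A) = Lcm (gcd m ` A)"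
  using assms by (induction A) (auto simp: gcd_lcm_distrib)

lemma g_Suc:
  assumes "n > 0"
  shows "g (Suc k) n = g k n * Lcm ((\<lambda>i. gcd (n + Suc k) (Suc k - i)) ` {0..k})"
proof -
  let ?L = "Lcm {n..n+k}" and ?m = "n + Suc k" and ?Q = "\<Prod>i=n..n+k. i"
  have ins: "{n..n + Suc k} = insert ?m {n..n+k}" by auto
  have L: "?L \<noteq> 0" using assms by (subst Lcm_0_iff) auto
  have "gcd ?m ?L = Lcm (gcd ?m ` {n..n+k})"
    by (rule gcd_Lcm_distrib) simp
  also have "gcd ?m ` {n..n+k} = (\<lambda>i. gcd ?m (n + i)) ` {0..k}"
    using image_image[of "gcd ?m" "\<lambda>i. n + i" "{0..k}"] by (simp add: add.commute)
  also have "\<dots> = (\<lambda>i. gcd ?m (Suc k - i)) ` {0..k}"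
  proof (rule image_cong)
    fix i assume "i \<in> {0..k}"
    then have *: "Suc k - i = ?m - (n + i)" "n + i \<le> ?m" by auto
    show "gcd ?m (n + i) = gcd ?m (Suc k - i)"
      unfolding *(1) using *(2) by (metis gcd.commute gcd_diff2_nat gcd_diff1_nat)
  qed simp
  finally have G: "gcd ?m ?L = Lcm ((\<lambda>i. gcd ?m (Suc k - i)) ` {0..k})" .
  have "?Q = g k n * ?L"
    using Lcm_dvd_prod[of n k] by (simp add: g_def)
  moreover have "(\<Prod>i=n..n+Suc k. i) = ?Q * ?m"
    unfolding ins by (simp add: mult.commute)
  ultimately have "(\<Prod>i=n..n+Suc k. i) = g k n * (?m * ?L)"
    by (simp add: mult_ac)
  also have "?m * ?L = gcd ?m ?L * lcm ?m ?L"
    by (rule prod_gcd_lcm_nat)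
  also have "lcm ?m ?L = Lcm {n..n+Suc k}"
    unfolding ins by simp
  finally have "(\<Prod>i=n..n+Suc k. i) = g k n * gcd ?m ?L * Lcm {n..n+Suc k}"
    by (simp only: mult.assoc)
  moreover have "Lcm {n..n+Suc k} \<noteq> 0"
    using assms by (subst Lcm_0_iff) auto
  ultimately have "g (Suc k) n = g k n * gcd ?m ?L"
    unfolding g_def[of "Suc k"] by simp
  then show ?thesis by (simp only: G)
qed

lemma g_add_multiple_fact:
  assumes "n > 0" "fact k dvd (T::nat)"
  shows "g k (n + T) = g k n"
  using assms(2)
proof (induction k)
  case 0
  show ?case using assms(1) by (simp add: g_def)
next
  case (Suc k)
  have "fact k dvd (fact (Suc k) :: nat)" by (simp add: fact_dvd)
  then have IH: "g k (n + T) = g k n" using Suc dvd_trans by blast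
  have "gcd (n + T + Suc k) (Suc k - i) = gcd (n + Suc k) (Suc k - i)" if "i \<in> {0..k}" for i
  proof -
    have "Suc k - i dvd fact (Suc k)" using that by (intro dvd_fact) auto
    then have "Suc k - i dvd T" using Suc.prems dvd_trans by blast
    then have "(n + T + Suc k) mod (Suc k - i) = (n + Suc k) mod (Suc k - i)"
      by (metis add.assoc add.commute dvdE mod_mult_self2)
    then show ?thesis by (metis gcd.commute gcd_red_nat)
  qed
  then have "(\<lambda>i. gcd (n + T + Suc k) (Suc k - i)) ` {0..k}
           = (\<lambda>i. gcd (n + Suc k) (Suc k - i)) ` {0..k}"
    by (rule image_cong[OF refl])
  then show ?case using assms(1) IH by (simp only: g_Suc add_pos_nonneg zero_le)
qed

lemma is_period_fact: "is_period k (fact k)"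
  by (simp add: is_period_def g_add_multiple_fact)

lemma is_period_P: "is_period k (P k)"
  unfolding P_def by (rule LeastI, rule is_period_fact)

lemma P_le: "is_period k T \<Longrightarrow> P k \<le> T"
  unfolding P_def by (rule Least_le)

end

theory Submission
  imports Defs
begin

text \<open>
  Put \<open>\<Lambda> = Lcm {1..k}\<close>. Splitting off either end of the window \<open>n, \<dots>, n + k + 1\<close> gives two
  factorisations of \<open>g\<close>, which combine to
  \<open>g k (n + 1) * gcd n \<Lambda> = g k n * gcd (n + k + 1) \<Lambda>\<close>. Both \<open>g k\<close> factors are unchanged when a
  period \<open>T\<close> is added to \<open>n\<close>; comparing at \<open>n = \<Lambda>\<close> yields
  \<open>\<Lambda> * gcd (T + k + 1) \<Lambda> = gcd (k + 1) \<Lambda> * gcd T \<Lambda>\<close>, so \<open>\<Lambda>\<close> divides \<open>(k + 1) * T\<close>.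
  Conversely, one of the factorisations shows by induction that \<open>\<Lambda>\<close> is itself a period.
\<close>

text \<open>Adjoining \<open>m\<close> multiplies the product by \<open>m\<close> but the lcm only
  by \<open>m\<close> over \<open>gcd m (Lcm A)\<close>.\<close>

lemma prod_div_Lcm_insert:
  fixes m :: nat
  assumes "finite A" "m \<notin> A" "m \<noteq> 0" "0 \<notin> A"
  shows "\<Prod>(insert m A) div Lcm (insert m A) = (\<Prod>A div Lcm A) * gcd m (Lcm A)"
proof -
  have "Lcm A dvd \<Prod>A"
    using assms(1) by (intro Lcm_least) (metis dvd_prodI)
  then have "\<Prod>(insert m A) = (\<Prod>A div Lcm A) * (m * Lcm A)"
    using assms by (simp add: mult_ac)
  also have "\<dots> = (\<Prod>A div Lcm A) * gcd m (Lcm A) * Lcm (insert m A)"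
    using prod_gcd_lcm_nat[of m "Lcm A"] by (simp only: Lcm_insert mult.assoc)
  finally show ?thesis
    using assms Lcm_0_iff[of "insert m A"] by simp
qed

text \<open>The differences \<open>Suc k - i\<close> in \<open>g_Suc\<close> run through
  \<open>{1..Suc k}\<close>, and gcd distributes over \<open>Lcm\<close>.\<close>

lemma g_Suc_right:
  assumes "n > 0"
  shows "g (Suc k) n = g k n * gcd (n + Suc k) (Lcm {1..Suc k})"
proof -
  have "(\<lambda>i. Suc k - i) ` {0..k} = {1..Suc k}"
  proof
    show "{1..Suc k} \<subseteq> (\<lambda>i. Suc k - i) ` {0..k}"
    proof
      fix j assume "j \<in> {1..Suc k}"
      then have "j = Suc k - (Suc k - j)" "Suc k - j \<in> {0..k}" by auto
      then show "j \<in> (\<lambda>i. Suc k - i) ` {0..k}" by blast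
    qed
  qed auto
  then have "(\<lambda>i. gcd (n + Suc k) (Suc k - i)) ` {0..k} = gcd (n + Suc k) ` {1..Suc k}"
    by (metis image_image)
  with assms show ?thesis
    by (simp only: g_Suc gcd_Lcm_distrib finite_atLeastAtMost)
qed

lemma g_Suc_left:
  assumes "n > 0"
  shows "g (Suc k) n = g k (n + 1) * gcd n (Lcm {1..Suc k})"
proof -
  let ?A = "{n + 1..n + 1 + k}"
  have "?A = (\<lambda>j. n + j) ` {1..Suc k}"
    by (simp add: add.commute)
  then have "gcd n ` ?A = gcd n ` {1..Suc k}"
    by (simp only: image_image gcd_add2)
  then have G: "gcd n (Lcm ?A) = gcd n (Lcm {1..Suc k})"
    by (simp only: gcd_Lcm_distrib finite_atLeastAtMost)
  have "{n..n + Suc k} = insert n ?A" by auto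
  then show ?thesis
    using prod_div_Lcm_insert[of ?A n] assms unfolding g_def G by simp
qed

text \<open>For \<open>k > 0\<close> the two windows share \<open>n + 1, ..., n + k\<close>, so both
  sides are \<open>g (k - 1) (n + 1)\<close> times the same two gcds.\<close>

lemma g_shift:
  assumes "n > 0"
  shows "g k (n + 1) * gcd n (Lcm {1..k}) = g k n * gcd (n + k + 1) (Lcm {1..k})"
proof (cases k)
  case 0
  then show ?thesis using assms by (simp add: g_def)
next
  case (Suc j)
  have "n + 1 + Suc j = n + k + 1" using Suc by simp
  with g_Suc_left[OF assms, of j] g_Suc_right[of "n + 1" j] show ?thesis
    unfolding Suc by (simp only: mult_ac add_pos_nonneg assms zero_le)
qed

lemma is_period_Lcm: "is_period k (Lcm {1..k})"
proof -
  \<comment> \<open>Allowing all multiples \<open>T\<close> lets the induction hypothesis apply,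
    since \<open>Lcm {1..k}\<close> divides \<open>Lcm {1..Suc k}\<close>.\<close>
  have "g k (n + T) = g k n" if "n > 0" "Lcm {1..k} dvd T" for n T
    using that(2)
  proof (induction k)
    case (Suc k)
    have "Lcm {1..k} dvd Lcm {1..Suc k}"
      by (intro Lcm_subset) auto
    then have "g k (n + T) = g k n"
      using Suc dvd_trans by blast
    moreover have "gcd (n + T + Suc k) (Lcm {1..Suc k}) = gcd (n + Suc k) (Lcm {1..Suc k})"
    proof -
      obtain c where "T = Lcm {1..Suc k} * c" using Suc.prems by (elim dvdE)
      then have "n + T + Suc k = c * Lcm {1..Suc k} + (n + Suc k)" by simp
      then show ?thesis by (metis gcd.commute gcd_add_mult)
    qed
    ultimately show ?case using that(1) by (simp only: g_Suc_right add_pos_nonneg zero_le)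
  qed (use that(1) in \<open>simp add: g_def\<close>)
  moreover have "Lcm {1..k} > 0"
    by (metis Lcm_0_iff atLeastAtMost_iff finite_atLeastAtMost gr0I not_one_le_zero)
  ultimately show ?thesis by (simp add: is_period_def)
qed

lemma is_period_imp_Lcm_dvd:
  assumes "is_period k T"
  shows "Lcm {1..k} dvd (k + 1) * T"
proof -
  let ?L = "Lcm {1..k}"
  have L: "?L > 0" using is_period_Lcm by (simp add: is_period_def)
  have per: "g k (n + T) = g k n" if "n > 0" for n
    using assms that by (simp add: is_period_def)
  \<comment> \<open>At \<open>n = ?L\<close> the factor \<open>gcd n ?L\<close> takes its largest
    value \<open>?L\<close>.\<close>
  let ?c = "g k ?L" and ?d = "g k (?L + 1)"
  have 1: "?d * ?L = ?c * gcd (k + 1) ?L"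
    using g_shift[OF L, of k] gcd_add2[of ?L "k + 1"] by (simp add: gcd.commute add.assoc)
  have "g k (?L + 1 + T) * gcd (?L + T) ?L = g k (?L + T) * gcd (?L + (T + k + 1)) ?L"
    using g_shift[of "?L + T" k] L by (simp add: add_ac)
  then have 2: "?d * gcd T ?L = ?c * gcd (T + k + 1) ?L"
    using per[OF L] per[of "?L + 1"] gcd_add2[of ?L T] gcd_add2[of ?L "T + k + 1"]
    by (simp add: gcd.commute add.assoc)
  \<comment> \<open>Cross-multiplying \<open>1\<close> and \<open>2\<close> lets the positive values
    \<open>?c\<close> and \<open>?d\<close> cancel, leaving only gcds.\<close>
  have "?c * ?d * (gcd (T + k + 1) ?L * ?L) = (?c * gcd (T + k + 1) ?L) * (?d * ?L)"
    by (simp only: mult_ac)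
  also have "\<dots> = ?c * ?d * (gcd (k + 1) ?L * gcd T ?L)"
    unfolding 1 2[symmetric] by (simp only: mult_ac)
  finally have "gcd (T + k + 1) ?L * ?L = gcd (k + 1) ?L * gcd T ?L"
    using g_pos[OF L, of k] g_pos[of "?L + 1" k] by simp
  then have "?L dvd gcd (k + 1) ?L * gcd T ?L" by (metis dvd_triv_right)
  also have "\<dots> dvd (k + 1) * T" by (intro mult_dvd_mono) auto
  finally show ?thesis .
qed

theorem corollary2p4:
  shows "(\<forall>k::nat. (Lcm {1..k+1} div (k+1)) dvd P k) \<and>
         (\<forall>k::nat. prime (k+1) \<longrightarrow> P k = Lcm {1..k})"
proof (intro conjI allI impI)
  fix k :: nat
  have "Lcm {1..k+1} = lcm (k + 1) (Lcm {1..k})"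
    by (simp add: atLeastAtMostSuc_conv)
  also have "\<dots> dvd (k + 1) * P k"
    by (intro lcm_least dvd_triv_left is_period_imp_Lcm_dvd is_period_P)
  finally show "(Lcm {1..k+1} div (k+1)) dvd P k"
    using Suc_dvd_Lcm[of k] by (subst div_dvd_iff_mult) (auto simp: mult.commute)
next
  fix k :: nat
  assume p: "prime (k+1)"
  have "Lcm {1..k} dvd fact k"
    by (intro Lcm_least) (auto intro: dvd_fact)
  moreover have "coprime (k + 1) (fact k)"
    using p by (intro prime_imp_coprime) (auto simp: prime_dvd_fact_iff)
  ultimately have "coprime (Lcm {1..k}) (k + 1)"
    by (metis coprime_commute coprime_divisors dvd_refl)
  then have "Lcm {1..k} dvd P k"
    using is_period_imp_Lcm_dvd[OF is_period_P, of k] by (simp only: coprime_dvd_mult_right_iff)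
  moreover have "P k > 0" using is_period_P by (simp add: is_period_def)
  ultimately show "P k = Lcm {1..k}"
    using P_le[OF is_period_Lcm] by (meson dvd_imp_le order.antisym)
qed

end
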